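(* Let $\mathcal{C}$ be an $[n,k,d]_q$ MDS code with $d\ge 3$. Then all its $n(q-1)$ cosets $\mathcal{V}^{(1)}$ of weight $1$ have the same weight distribution, namely: $$B_w(\mathcal{V}^{(1)})=0\ \text{ if } w\in\{0,1,\ldots,d-2\}\setminus\{1\};\qquad B_1(\mathcal{V}^{(1)})=1;\qquad B_{d-1}(\mathcal{V}^{(1)})=\binom{n-1}{d-1};$$ $$B_w(\mathcal{V}^{(1)})=A_w(\mathcal{C})-\Omega_w^{(0)}(n,d)+\Omega_w^{(1)}(n,d),\qquad w=d,d+1,\ldots,n.$$
   Context: An $[n,k,d]_q$ code is a $k$-dimensional $\mathbb{F}_q$-linear subspace of $\mathbb{F}_q^n$ with minimum Hamming distance $d$; it is MDS if $d=n-k+1$. A coset of $\mathcal{C}$ is a translate $\mathcal{C}+\mathbf{v}$, $\mathbf{v}\in\mathbb{F}_q^n$; the weight of a coset is the smallest Hamming weight of a vector in it. $A_w(\mathcal{C})$ is the number of codewords of Hamming weight $w$ in $\mathcal{C}$, and $B_w(\mathcal{V})$ is the number of vectors of Hamming weight $w$ in the coset $\mathcal{V}$. Notation: $\Omega_w^{(v)}(n,d)=(-1)^{w-d}\binom{n-v}{w-v}\binom{w-1-v}{d-2-v}$. *)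

theory Defs
  imports "HOL-Analysis.Cartesian_Space"
begin

text \<open>The space of vectors of length $n$ over the field with $q$ elements is \<open>'q ^ 'n\<close>, with
  \<open>'q :: {field, finite}\<close>, $q =$ \<open>CARD('q)\<close> and $n =$ \<open>CARD('n)\<close>; the prefix \<open>vec\<close> refers to
  linear algebra over \<open>'q\<close> itself.\<close>

definition hamming_weight :: "'q::zero ^ 'n::finite \<Rightarrow> nat" where
  "hamming_weight x = card {i. x $ i \<noteq> 0}"

definition hamming_dist :: "'q ^ 'n::finite \<Rightarrow> 'q ^ 'n \<Rightarrow> nat" where
  "hamming_dist x y = card {i. x $ i \<noteq> y $ i}"

text \<open>A relation rather than a function, so that a code with fewer than two words has no
  minimum distance.\<close>

definition is_min_distance :: "('q ^ 'n::finite) set \<Rightarrow> nat \<Rightarrow> bool" where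
  "is_min_distance C d \<longleftrightarrow>
     (\<exists>x\<in>C. \<exists>y\<in>C. x \<noteq> y \<and> hamming_dist x y = d) \<and>
     (\<forall>x\<in>C. \<forall>y\<in>C. x \<noteq> y \<longrightarrow> d \<le> hamming_dist x y)"

definition linear_code :: "('q::{field,finite} ^ 'n::finite) set \<Rightarrow> nat \<Rightarrow> nat \<Rightarrow> bool" where
  "linear_code C k d \<longleftrightarrow> vec.subspace C \<and> vec.dim C = k \<and> is_min_distance C d"

text \<open>The subtraction does not truncate, since $k \le n$.\<close>

definition MDS_code :: "('q::{field,finite} ^ 'n::finite) set \<Rightarrow> nat \<Rightarrow> nat \<Rightarrow> bool" where
  "MDS_code C k d \<longleftrightarrow> linear_code C k d \<and> d = CARD('n) - k + 1"

definition cosets :: "('q::{field,finite} ^ 'n::finite) set \<Rightarrow> ('q ^ 'n) set set" where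
  "cosets C = {(\<lambda>c. c + v) ` C | v. True}"

definition min_weight :: "('q::{field,finite} ^ 'n::finite) set \<Rightarrow> nat" where
  "min_weight V = Min (hamming_weight ` V)"

text \<open>Both $A_w(C)$, for a code, and $B_w(V)$, for a coset.\<close>

definition weight_count :: "nat \<Rightarrow> ('q::{field,finite} ^ 'n::finite) set \<Rightarrow> nat" where
  "weight_count w V = card {x \<in> V. hamming_weight x = w}"

text \<open>Meaningful for $v + 2 \le d \le w$ and $v \le n$, where no subtraction truncates.\<close>

definition Omega :: "nat \<Rightarrow> nat \<Rightarrow> nat \<Rightarrow> nat \<Rightarrow> int" where
  "Omega v w n d =
     (-1) ^ (w - d) * int ((n - v) choose (w - v)) * int ((w - 1 - v) choose (d - 2 - v))"

end

theory Submission
  imports Defs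
begin

text \<open>The vectors of a coset supported in a set $S$ of at least $d - 1$ positions are as many as the
  codewords supported in $S$: as $C$ meets the vectors supported in $d - 1$ positions only in $0$, a
  dimension count makes the two subspaces span the whole space, so every coset has a vector supported
  in $S$. For smaller $S$ both counts are at most $1$. So the two counting functions differ only at the
  sets $S$ with at most $d - 2$ elements that avoid the position of the coset leader, and Moebius
  inversion over the subsets of a support gives the difference of the weight distributions.\<close>

section \<open>Supports of vectors\<close>

definition supp :: "'q::zero ^ 'n::finite \<Rightarrow> 'n set" where
  "supp x = {i. x $ i \<noteq> 0}"

lemma hamming_weight_eq_card_supp: "hamming_weight x = card (supp x)"
  by (simp add: hamming_weight_def supp_def)

lemma supp_subset_iff: "supp x \<subseteq> S \<longleftrightarrow> (\<forall>i. i \<notin> S \<longrightarrow> x $ i = 0)"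
  by (auto simp: supp_def)

lemma hamming_weight_0_iff: "hamming_weight x = 0 \<longleftrightarrow> x = 0"
  by (auto simp: hamming_weight_eq_card_supp supp_def vec_eq_iff)

lemma supp_axis: "a \<noteq> 0 \<Longrightarrow> supp (axis j a) = {j}"
  by (auto simp: supp_def axis_def)

lemma hamming_weight_1_obtain:
  assumes "hamming_weight x = 1"
  obtains j a where "a \<noteq> 0" "x = axis j a"
proof -
  obtain j where j: "supp x = {j}"
    using assms by (auto simp: hamming_weight_eq_card_supp card_1_singleton_iff)
  then have "x $ j \<noteq> 0" "\<And>i. i \<noteq> j \<Longrightarrow> x $ i = 0" by (auto simp: supp_def)
  then show ?thesis using that[of "x $ j" j] by (auto simp: vec_eq_iff axis_def)
qed

lemma supp_diff_subset: "supp (x - y) \<subseteq> supp x \<union> supp (y :: 'q::ab_group_add ^ 'n::finite)"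
  by (auto simp: supp_def)

lemma hamming_dist_eq_weight: "hamming_dist x y = hamming_weight (x - y :: 'q::ab_group_add ^ 'n::finite)"
  by (simp add: hamming_dist_def hamming_weight_def)

section \<open>Counting vectors by support\<close>

lemma card_supp_family:
  fixes V :: "('q::{zero,finite} ^ 'n::finite) set"
  shows "card {x \<in> V. supp x \<in> F} = (\<Sum>W\<in>F. card {x \<in> V. supp x = W})"
proof -
  have "{x \<in> V. supp x \<in> F} = (\<Union>W\<in>F. {x \<in> V. supp x = W})" by auto
  then show ?thesis by (auto intro!: card_UN_disjoint)
qed

lemma weight_count_eq_sum:
  "weight_count w V = (\<Sum>W | card W = w. card {x \<in> V. supp x = W})"
  using card_supp_family[of V "{W. card W = w}"]
  by (simp add: weight_count_def hamming_weight_eq_card_supp)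

text \<open>Moebius inversion over the subsets of \<open>W\<close>: sorting vectors by exact support
  makes the counts for supports inside a set sums of the counts for exact supports.\<close>

lemma card_supp_eq_mobius:
  fixes V :: "('q::{zero,finite} ^ 'n::finite) set"
  shows "int (card {x \<in> V. supp x = W}) =
    (\<Sum>T \<in> Pow W. (-1) ^ (card W - card T) * int (card {x \<in> V. supp x \<subseteq> T}))"
proof (rule inclusion_exclusion_mobius)
  show "int (card {x \<in> V. supp x \<subseteq> S}) = (\<Sum>W\<in>Pow S. int (card {x \<in> V. supp x = W}))" for S
    using card_supp_family[of V "Pow S"] by simp
qed simp

section \<open>Alternating binomial sums and counts of subsets\<close>

lemma sum_lower_alternating_choose:
  "(\<Sum>k\<le>m. (-1) ^ k * int (Suc n choose k)) = (-1) ^ m * int (n choose m)"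
  \<comment> \<open>By Pascal's rule the new term is \<open>(-1) ^ Suc m\<close> times
    \<open>(n choose m) + (n choose Suc m)\<close>; its first part cancels the sum so far.\<close>
  by (induction m) (auto simp: algebra_simps)

text \<open>Grouping by cardinality leaves a truncated alternating row of Pascal's triangle.
  Nonemptiness makes \<open>card A\<close> a successor, as the closed form of that row
  requires.\<close>

lemma sum_alternating_subsets:
  assumes "finite A" "A \<noteq> {}"
  shows "(\<Sum>T | T \<subseteq> A \<and> card T \<le> m. (-1) ^ card T) = (-1) ^ m * int ((card A - 1) choose m)"
proof -
  have "(\<Sum>T | T \<subseteq> A \<and> card T \<le> m. (-1) ^ card T :: int) =
      (\<Sum>k\<le>m. \<Sum>T | T \<in> {T. T \<subseteq> A \<and> card T \<le> m} \<and> card T = k. (-1) ^ card T)"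
    using assms by (intro sum.group[symmetric]) auto
  also have "\<dots> = (\<Sum>k\<le>m. (-1) ^ k * int (card A choose k))"
  proof (rule sum.cong)
    fix k assume "k \<in> {..m}"
    then have "{T. T \<in> {T. T \<subseteq> A \<and> card T \<le> m} \<and> card T = k} = {T. T \<subseteq> A \<and> card T = k}" by auto
    then show "(\<Sum>T | T \<in> {T. T \<subseteq> A \<and> card T \<le> m} \<and> card T = k. (-1) ^ card T) =
        (-1) ^ k * int (card A choose k)"
      using assms by (simp add: n_subsets mult.commute)
  qed simp
  also have "\<dots> = (-1) ^ m * int ((card A - 1) choose m)"
    using assms sum_lower_alternating_choose[of "card A - 1" m]
    by (simp add: card_gt_0_iff)
  finally show ?thesis .
qed

lemma card_subsets_avoiding:
  "card {W :: 'n::finite set. card W = w \<and> j \<notin> W} = (CARD('n) - 1) choose w"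
proof -
  have "{W :: 'n set. card W = w \<and> j \<notin> W} = {W. W \<subseteq> UNIV - {j} \<and> card W = w}" by auto
  then show ?thesis by (simp add: n_subsets card_Diff_singleton)
qed

lemma card_subsets_containing:
  assumes "w > 0"
  shows "card {W :: 'n::finite set. card W = w \<and> j \<in> W} = (CARD('n) - 1) choose (w - 1)"
proof -
  have "card {W :: 'n set. card W = w} =
      card {W :: 'n set. card W = w \<and> j \<in> W} + card {W. card W = w \<and> j \<notin> W}"
    by (subst card_Un_disjoint[symmetric]) (auto intro: arg_cong[where f = card])
  moreover have "card {W :: 'n set. card W = w} = CARD('n) choose w"
    using n_subsets[of "UNIV :: 'n set" w] by simp
  moreover have "CARD('n) choose w = ((CARD('n) - 1) choose (w - 1)) + ((CARD('n) - 1) choose w)"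
    using assms choose_reduce_nat[of "CARD('n)" w] by simp
  ultimately show ?thesis by (simp add: card_subsets_avoiding)
qed

section \<open>Cosets of a linear code and their vectors supported in a given set\<close>

lemma coset_mem_iff: "x \<in> (\<lambda>c. c + v) ` C \<longleftrightarrow> x - v \<in> C" for v :: "'a::ab_group_add"
  by force

lemma coset_eq_if_diff_mem:
  assumes "vec.subspace C" "x - v \<in> C"
  shows "(\<lambda>c. c + v) ` C = (\<lambda>c. c + x) ` C"
proof -
  have "y - v \<in> C \<longleftrightarrow> y - x \<in> C" for y
    using vec.subspace_add[OF assms(1), of "y - x" "x - v"]
      vec.subspace_diff[OF assms(1), of "y - v" "x - v"] assms(2) by auto
  then show ?thesis by (intro set_eqI) (simp only: coset_mem_iff)
qed

locale mds =
  fixes C :: "('q::{field,finite} ^ 'n::finite) set" and k d :: nat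
  assumes mds: "MDS_code C k d"
begin

lemma subspace: "vec.subspace C"
  and dim: "vec.dim C = k"
  and min_dist: "is_min_distance C d"
  and d_eq: "d = CARD('n) - k + 1"
  using mds by (auto simp: MDS_code_def linear_code_def)

lemma eq_0_if_weight_less:
  assumes "c \<in> C" "card (supp c) < d"
  shows "c = 0"
proof (rule ccontr)
  assume "c \<noteq> 0"
  then have "d \<le> hamming_dist c 0"
    using min_dist assms(1) vec.subspace_0[OF subspace] by (auto simp: is_min_distance_def)
  then show False
    using assms(2) by (simp add: hamming_dist_eq_weight hamming_weight_eq_card_supp)
qed

text \<open>The difference of two vectors of a coset is a codeword; here it lives on fewer than
  \<open>d\<close> positions and so vanishes.\<close>

lemma eq_if_supp_subset:
  assumes "x - v \<in> C" "y - v \<in> C" "supp x \<subseteq> S" "supp y \<subseteq> S" "card S < d"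
  shows "x = y"
proof -
  have "x - y \<in> C" using vec.subspace_diff[OF subspace assms(1,2)] by simp
  moreover have "card (supp (x - y)) \<le> card S"
    using supp_diff_subset[of x y] assms by (intro card_mono) auto
  ultimately show ?thesis using eq_0_if_weight_less[of "x - y"] assms(5) by simp
qed

lemma coset_has_vector_supported:
  assumes "d - 1 \<le> card S"
  obtains x where "x - v \<in> C" "supp x \<subseteq> S"
proof -
  \<comment> \<open>Exactly \<open>d - 1\<close> positions are kept, so that the dimensions
    \<open>k\<close> and \<open>d - 1\<close> add up to \<open>CARD('n)\<close>.\<close>
  obtain S' where S': "S' \<subseteq> S" "card S' = d - 1"
    using obtain_subset_with_card_n[OF assms] by auto
  define U where "U = {x :: 'q ^ 'n. \<forall>i. i \<notin> S' \<longrightarrow> x $ i = 0}"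
  have U: "vec.subspace U" by (auto simp: U_def vec.subspace_def)
  have dimU: "vec.dim U = d - 1" using S' by (simp add: U_def dim_substandard_cart)
  have "supp x \<subseteq> S'" if "x \<in> U" for x using that by (auto simp: U_def supp_def)
  then have "C \<inter> U \<subseteq> {0}"
    using eq_0_if_weight_less S' d_eq by (metis Int_iff card_mono finite le_imp_less_Suc
        singletonI subsetI Suc_eq_plus1 diff_add_inverse2)
  then have "vec.dim (C \<inter> U) = 0" by simp
  moreover have "k \<le> CARD('n)" using dim dim_subset_UNIV_cart_gen by metis
  ultimately have "vec.dim {x + y |x y. x \<in> C \<and> y \<in> U} = CARD('n)"
    using vec.dim_sums_Int[OF subspace U] dimU dim d_eq by linarith
  then have "vec.span {x + y |x y. x \<in> C \<and> y \<in> U} = UNIV"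
    by (simp add: card_cart_basis vec.dimension_def flip: vec.dim_eq_full)
  then have "{x + y |x y. x \<in> C \<and> y \<in> U} = UNIV"
    by (simp only: vec.span_eq_iff[THEN iffD2, OF vec.subspace_sums[OF subspace U]])
  then obtain c u where "v = c + u" "c \<in> C" "u \<in> U" by blast
  \<comment> \<open>Here \<open>u = v - c\<close>, so \<open>u - v = - c\<close> is a
    codeword.\<close>
  then have "u - v \<in> C" "supp u \<subseteq> S"
    using vec.subspace_neg[OF subspace, of c] S' by (auto simp: U_def supp_def)
  then show ?thesis by (rule that)
qed

text \<open>With a representative \<open>u\<close> that is itself supported in \<open>S\<close>,
  adding \<open>u\<close> maps the codewords supported in \<open>S\<close> bijectively to the coset
  vectors supported in \<open>S\<close>.\<close>

lemma card_coset_supp_subset_large: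
  assumes "d - 1 \<le> card S"
  shows "card {x \<in> (\<lambda>c. c + v) ` C. supp x \<subseteq> S} = card {x \<in> C. supp x \<subseteq> S}"
proof -
  obtain u where u: "u - v \<in> C" "supp u \<subseteq> S" by (rule coset_has_vector_supported[OF assms])
  have "(\<lambda>c. c + v) ` C = (\<lambda>c. c + u) ` C" by (rule coset_eq_if_diff_mem[OF subspace u(1)])
  moreover have "supp (c + u) \<subseteq> S \<longleftrightarrow> supp c \<subseteq> S" for c
    using u(2) by (simp add: supp_subset_iff)
  ultimately have "{x \<in> (\<lambda>c. c + v) ` C. supp x \<subseteq> S} = (\<lambda>c. c + u) ` {x \<in> C. supp x \<subseteq> S}" by auto
  then show ?thesis by (simp add: card_image)
qed

lemma card_supp_subset_small:
  assumes "card S < d"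
  shows "card {x \<in> C. supp x \<subseteq> S} = 1"
proof -
  have "{x \<in> C. supp x \<subseteq> S} = {0}"
    using eq_if_supp_subset[of _ 0 0 S] vec.subspace_0[OF subspace] assms by (auto simp: supp_def)
  then show ?thesis by simp
qed

end

section \<open>The coset with leader \<open>axis j a\<close>\<close>

locale mds_weight_one_coset = mds C k d
  for C :: "('q::{field,finite} ^ 'n::finite) set" and k d :: nat +
  fixes j :: 'n and a :: 'q
  assumes d_ge: "d \<ge> 3" and a_nz: "a \<noteq> 0"
begin

definition V where "V = (\<lambda>c. c + axis j a) ` C"

lemma V_mem_iff: "x \<in> V \<longleftrightarrow> x - axis j a \<in> C"
  by (simp add: V_def coset_mem_iff)

lemma leader_mem: "axis j a \<in> V"
  by (simp add: V_mem_iff vec.subspace_0[OF subspace])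

text \<open>Position \<open>j\<close> is counted along so that one set of fewer than
  \<open>d\<close> positions supports both \<open>x\<close> and the leader; such a set carries at
  most one vector of the coset.\<close>

lemma eq_leader:
  assumes "x \<in> V" "card (insert j (supp x)) < d"
  shows "x = axis j a"
proof (rule eq_if_supp_subset)
  show "x - axis j a \<in> C" "axis j a - axis j a \<in> C"
    using assms(1) leader_mem by (simp_all only: V_mem_iff)
  show "supp (axis j a) \<subseteq> insert j (supp x)" by (simp add: supp_axis a_nz)
qed (use assms in auto)

lemma eq_leader_if_small:
  assumes "x \<in> V" "card (supp x) < d - 1"
  shows "x = axis j a"
proof (rule eq_leader)
  have "card (insert j (supp x)) \<le> Suc (card (supp x))" by (simp add: card_insert_if)
  then show "card (insert j (supp x)) < d" using assms(2) by linarith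
qed (rule assms)

lemma card_V_supp_subset_small:
  assumes "card S < d - 1"
  shows "card {x \<in> V. supp x \<subseteq> S} = (if j \<in> S then 1 else 0)"
proof -
  have "x = axis j a" if "x \<in> V" "supp x \<subseteq> S" for x
    using eq_leader_if_small[OF that(1)] card_mono[OF _ that(2)] assms by simp
  then have "x \<in> V \<and> supp x \<subseteq> S \<longleftrightarrow> x = axis j a \<and> j \<in> S" for x
    using leader_mem supp_axis[OF a_nz, of j] by (metis empty_subsetI insert_subset)
  then have "{x \<in> V. supp x \<subseteq> S} = (if j \<in> S then {axis j a} else {})" by simp
  then show ?thesis by simp
qed

text \<open>Up to \<open>d - 2\<close> positions carry only the zero codeword and, in the coset, at
  most the leader, which needs \<open>j\<close>. From \<open>d - 1\<close> positions on the counts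
  agree.\<close>

lemma supp_subset_difference:
  "int (card {x \<in> V. supp x \<subseteq> S}) - int (card {x \<in> C. supp x \<subseteq> S}) =
    (if card S \<le> d - 2 \<and> j \<notin> S then - 1 else 0)"
proof (cases "card S \<le> d - 2")
  case True
  then have "card S < d - 1" "card S < d" using d_ge by linarith+
  then show ?thesis using card_V_supp_subset_small[of S] card_supp_subset_small[of S] True by simp
next
  case False
  then show ?thesis using card_coset_supp_subset_large[of S "axis j a"] by (simp add: V_def)
qed

text \<open>Moebius inversion is linear, so it applies to the difference of the two counts; only
  sets \<open>T\<close> inside \<open>W - {j}\<close> with at most \<open>d - 2\<close> elements
  contribute.\<close>

lemma supp_eq_difference:
  assumes "card W \<ge> d"
  shows "int (card {x \<in> V. supp x = W}) - int (card {x \<in> C. supp x = W}) =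
    - ((-1) ^ (card W - d) * int ((card (W - {j}) - 1) choose (d - 2)))"
proof -
  have ne: "W - {j} \<noteq> {}"
    using assms d_ge card_mono[of "{j}" W] by auto
  have "int (card {x \<in> V. supp x = W}) - int (card {x \<in> C. supp x = W}) =
      (\<Sum>T \<in> Pow W. (-1) ^ (card W - card T) * (if card T \<le> d - 2 \<and> j \<notin> T then - 1 else 0))"
    unfolding card_supp_eq_mobius supp_subset_difference[symmetric]
    by (simp add: sum_subtractf right_diff_distrib)
  also have "\<dots> = (\<Sum>T | T \<subseteq> W - {j} \<and> card T \<le> d - 2. - ((-1) ^ (card W - card T)))"
    by (rule sum.mono_neutral_cong_right) auto
  \<comment> \<open>As \<open>card T\<close> is at most \<open>card W\<close>, the difference and
    the sum of the two sizes have equal parity, which lets the sign factor.\<close>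
  also have "\<dots> = (\<Sum>T | T \<subseteq> W - {j} \<and> card T \<le> d - 2. - ((-1) ^ card W * (-1) ^ card T))"
  proof (rule sum.cong)
    fix T assume "T \<in> {T. T \<subseteq> W - {j} \<and> card T \<le> d - 2}"
    then have "card T \<le> card W" by (intro card_mono) auto
    then show "- ((-1) ^ (card W - card T)) = - ((-1) ^ card W * (-1) ^ card T :: int)"
      by (simp add: neg_one_power_add_eq_neg_one_power_diff flip: power_add)
  qed simp
  also have "\<dots> = - ((-1) ^ card W * ((-1) ^ (d - 2) * int ((card (W - {j}) - 1) choose (d - 2))))"
    using sum_alternating_subsets[of "W - {j}" "d - 2"] ne
    by (simp add: sum_negf flip: sum_distrib_left)
  also have "(-1) ^ card W * ((-1) ^ (d - 2) * int ((card (W - {j}) - 1) choose (d - 2))) =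
      (-1) ^ (card W - d) * int ((card (W - {j}) - 1) choose (d - 2))"
  proof -
    \<comment> \<open>The two exponents differ by \<open>2 * d - 2\<close>.\<close>
    have "even (card W + (d - 2)) \<longleftrightarrow> even (card W - d)" using assms d_ge by presburger
    then have "(-1) ^ (card W + (d - 2)) = ((-1) ^ (card W - d) :: int)"
      by (simp only: minus_one_power_iff)
    then show ?thesis by (simp add: power_add mult.assoc)
  qed
  finally show ?thesis .
qed

text \<open>The difference at a support depends only on its size and on whether it contains
  \<open>j\<close>, so the supports of size \<open>w\<close> fall into two classes, each with a
  constant contribution.\<close>

lemma weight_count_large:
  assumes "d \<le> w" "w \<le> CARD('n)"
  shows "int (weight_count w V) =
    int (weight_count w C) - Omega 0 w (CARD('n)) d + Omega 1 w (CARD('n)) d"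
proof -
  let ?n = "CARD('n)" and ?s = "(-1) ^ (w - d) :: int"
  let ?f = "\<lambda>W. - (?s * int ((card (W - {j}) - 1) choose (d - 2)))"
  have "int (weight_count w V) - int (weight_count w C) = (\<Sum>W | card W = w. ?f W)"
    using assms(1) unfolding weight_count_eq_sum
    by (simp add: supp_eq_difference flip: sum_subtractf)
  also have "\<dots> = (\<Sum>W | card W = w \<and> j \<notin> W. ?f W) + (\<Sum>W | card W = w \<and> j \<in> W. ?f W)"
    by (subst sum.union_disjoint[symmetric]) (auto intro: sum.cong)
  also have "(\<Sum>W | card W = w \<and> j \<notin> W. ?f W) =
      - (?s * int ((w - 1) choose (d - 2)) * int ((?n - 1) choose w))"
    by (simp add: card_subsets_avoiding)
  also have "(\<Sum>W | card W = w \<and> j \<in> W. ?f W) =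
      - (?s * int ((w - 2) choose (d - 2)) * int ((?n - 1) choose (w - 1)))"
    using assms d_ge by (simp add: card_subsets_containing card_Diff_singleton numeral_2_eq_2)
  finally have diff: "int (weight_count w V) - int (weight_count w C) =
    - (?s * int ((w - 1) choose (d - 2)) * int ((?n - 1) choose w))
    - ?s * int ((w - 2) choose (d - 2)) * int ((?n - 1) choose (w - 1))" by simp
  \<comment> \<open>Both binomials of \<open>Omega 0\<close> are expanded; the product of
    \<open>(w - 2) choose (d - 3)\<close> and \<open>(?n - 1) choose (w - 1)\<close> cancels against
    \<open>Omega 1\<close>, and the other products are those in \<open>diff\<close>.\<close>
  have pascal: "?n choose w = ((?n - 1) choose (w - 1)) + ((?n - 1) choose w)"
    "(w - 1) choose (d - 2) = ((w - 2) choose (d - 3)) + ((w - 2) choose (d - 2))"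
    using assms d_ge choose_reduce_nat[of ?n w] choose_reduce_nat[of "w - 1" "d - 2"]
    by (auto simp: numeral_2_eq_2 numeral_3_eq_3)
  have "w - 1 - 1 = w - 2" "d - 2 - 1 = d - 3" by auto
  then show ?thesis
    using diff unfolding Omega_def diff_zero pascal by (simp add: algebra_simps)
qed

section \<open>Weights below \<open>d\<close>, weights above the length, and the minimum
  weight\<close>

lemma weight_count_1: "weight_count 1 V = 1"
proof -
  \<comment> \<open>As \<open>d \<ge> 3\<close>, weight 1 lies below \<open>d - 1\<close>, where
    only the leader can occur.\<close>
  have "x = axis j a" if "x \<in> V" "hamming_weight x = 1" for x
    using that d_ge by (intro eq_leader_if_small) (auto simp: hamming_weight_eq_card_supp)
  moreover have "hamming_weight (axis j a) = 1"
    by (simp add: hamming_weight_eq_card_supp supp_axis a_nz)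
  ultimately have "{x \<in> V. hamming_weight x = 1} = {axis j a}" using leader_mem by blast
  then show ?thesis by (simp add: weight_count_def)
qed

lemma weight_count_small:
  assumes "w \<le> d - 2" "w \<noteq> 1"
  shows "weight_count w V = 0"
proof -
  have "hamming_weight x \<noteq> w" if "x \<in> V" for x
  proof
    assume "hamming_weight x = w"
    moreover from this have "x = axis j a"
      using that assms d_ge by (intro eq_leader_if_small) (auto simp: hamming_weight_eq_card_supp)
    ultimately show False
      using assms by (simp add: hamming_weight_eq_card_supp supp_axis a_nz)
  qed
  then have "{x \<in> V. hamming_weight x = w} = {}" by blast
  then show ?thesis by (simp add: weight_count_def)
qed

text \<open>A set of \<open>d - 1\<close> positions carries exactly one vector of the coset, and
  that vector fills the set precisely when \<open>j\<close> lies outside it.\<close>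

lemma weight_count_pred: "weight_count (d - 1) V = (CARD('n) - 1) choose (d - 1)"
proof -
  have "bij_betw supp {x \<in> V. hamming_weight x = d - 1} {W. card W = d - 1 \<and> j \<notin> W}"
  proof (rule bij_betw_imageI)
    show "inj_on supp {x \<in> V. hamming_weight x = d - 1}"
    proof (rule inj_onI)
      fix x y
      assume "x \<in> {x \<in> V. hamming_weight x = d - 1}" "y \<in> {x \<in> V. hamming_weight x = d - 1}"
        "supp x = supp y"
      then show "x = y"
        using d_ge eq_if_supp_subset[of x "axis j a" y "supp x"]
        by (auto simp: V_mem_iff hamming_weight_eq_card_supp)
    qed
    have "j \<notin> supp x" if "x \<in> V" "card (supp x) = d - 1" for x
    proof
      assume "j \<in> supp x"
      \<comment> \<open>Inserting \<open>j\<close> adds nothing to the support, so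
        \<open>eq_leader\<close> still applies at size \<open>d - 1\<close>; it yields weight 1,
        while \<open>d - 1 \<ge> 2\<close>.\<close>
      then have "x = axis j a" using that d_ge by (intro eq_leader) (auto simp: insert_absorb)
      then show False using that d_ge by (simp add: supp_axis a_nz)
    qed
    moreover have "W \<in> supp ` {x \<in> V. card (supp x) = d - 1}" if "card W = d - 1" "j \<notin> W" for W
    proof -
      obtain x where x: "x - axis j a \<in> C" "supp x \<subseteq> W"
        using coset_has_vector_supported[of W "axis j a"] \<open>card W = d - 1\<close> by auto
      \<comment> \<open>A smaller support would force the leader, whose support \<open>{j}\<close>
        is not contained in \<open>W\<close>.\<close>
      have "\<not> card (supp x) < d - 1"
        using eq_leader_if_small[of x] x that(2) supp_axis[OF a_nz, of j] by (auto simp: V_mem_iff)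
      then have "supp x = W" using card_seteq[OF _ x(2)] that(1) by simp
      then show ?thesis using x that(1) by (auto simp: V_mem_iff)
    qed
    ultimately show "supp ` {x \<in> V. hamming_weight x = d - 1} = {W. card W = d - 1 \<and> j \<notin> W}"
      by (auto simp: hamming_weight_eq_card_supp)
  qed
  from bij_betw_same_card[OF this] show ?thesis
    by (simp add: weight_count_def card_subsets_avoiding)
qed

text \<open>Two cosets are to agree at every natural \<open>w\<close>; this settles the weights
  beyond the range of the formula.\<close>

lemma weight_count_above:
  assumes "CARD('n) < w"
  shows "weight_count w V = 0"
proof -
  have "hamming_weight x \<le> CARD('n)" for x :: "'q ^ 'n"
    by (simp add: hamming_weight_eq_card_supp card_mono)
  then have "{x \<in> V. hamming_weight x = w} = {}"
    using assms by (auto simp: not_le[symmetric])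
  then show ?thesis by (simp add: weight_count_def)
qed

lemma min_weight_V: "min_weight V = 1"
  unfolding min_weight_def
proof (rule Min_eqI)
  show "1 \<in> hamming_weight ` V"
    using leader_mem by (force simp: hamming_weight_eq_card_supp supp_axis a_nz)
  show "1 \<le> y" if "y \<in> hamming_weight ` V" for y
  proof (rule ccontr)
    assume "\<not> 1 \<le> y"
    with that obtain x where "x \<in> V" "hamming_weight x = 0" by auto
    then have "0 \<in> V" by (simp add: hamming_weight_0_iff)
    then have "0 = axis j a" using d_ge by (intro eq_leader_if_small) (auto simp: supp_def)
    then show False using a_nz by (simp add: axis_eq_0_iff)
  qed
qed simp

end

section \<open>All cosets of weight one\<close>

context mds
begin

lemma weight_one_coset_obtain:
  assumes "V \<in> cosets C" "min_weight V = 1"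
  obtains j a where "a \<noteq> 0" "V = (\<lambda>c. c + axis j a) ` C"
proof -
  obtain v where v: "V = (\<lambda>c. c + v) ` C" using assms(1) by (auto simp: cosets_def)
  have "C \<noteq> {}" using vec.subspace_0[OF subspace] by auto
  then have "1 \<in> hamming_weight ` V"
    using Min_in[of "hamming_weight ` V"] assms(2) unfolding min_weight_def v by simp
  then obtain x where x: "x \<in> V" "hamming_weight x = 1" by force
  obtain j a where "a \<noteq> 0" "x = axis j a" using hamming_weight_1_obtain[OF x(2)] .
  moreover have "V = (\<lambda>c. c + x) ` C"
    unfolding v using x(1) by (intro coset_eq_if_diff_mem[OF subspace]) (simp add: v coset_mem_iff)
  ultimately show ?thesis using that by auto
qed

text \<open>Each such coset has a single leader, given by its position and its nonzero entry, so
  these pairs parametrize the cosets bijectively.\<close>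

lemma card_weight_one_cosets:
  assumes "d \<ge> 3"
  shows "card {V \<in> cosets C. min_weight V = 1} = CARD('n) * (CARD('q) - 1)"
proof -
  let ?f = "\<lambda>(j, a). (\<lambda>c. c + axis j a) ` C"
  have "inj_on ?f (UNIV \<times> (UNIV - {0}))"
  proof (rule inj_onI)
    fix p q :: "'n \<times> 'q"
    assume pq: "p \<in> UNIV \<times> (UNIV - {0})" "q \<in> UNIV \<times> (UNIV - {0})" "?f p = ?f q"
    obtain j a l b where p: "p = (j, a)" and q: "q = (l, b)" by (cases p, cases q)
    have nz: "a \<noteq> 0" "b \<noteq> 0"
      and eq: "(\<lambda>c. c + axis j a) ` C = (\<lambda>c. c + axis l b) ` C"
      using pq by (simp_all add: p q)
    interpret mds_weight_one_coset C k d j a by unfold_locales (use nz assms in auto)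
    interpret l: mds_weight_one_coset C k d l b by unfold_locales (use nz assms in auto)
    have "axis l b \<in> V" using l.leader_mem eq by (simp add: V_def l.V_def)
    \<comment> \<open>The positions \<open>l\<close> and \<open>j\<close> together are at most two,
      fewer than \<open>d\<close>.\<close>
    then have "axis l b = axis j a"
      using assms nz by (intro eq_leader) (auto simp: supp_axis card_insert_if)
    then show "p = q" using nz by (auto simp: axis_eq_axis p q)
  qed
  then have "card (?f ` (UNIV \<times> (UNIV - {0}))) = card ((UNIV :: 'n set) \<times> (UNIV - {0 :: 'q}))"
    by (rule card_image)
  moreover have "?f ` (UNIV \<times> (UNIV - {0})) = {V \<in> cosets C. min_weight V = 1}"
  proof
    show "?f ` (UNIV \<times> (UNIV - {0})) \<subseteq> {V \<in> cosets C. min_weight V = 1}"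
    proof (rule image_subsetI)
      fix p :: "'n \<times> 'q" assume "p \<in> UNIV \<times> (UNIV - {0})"
      then obtain j a where p: "p = (j, a)" and "a \<noteq> 0" by auto
      interpret mds_weight_one_coset C k d j a by unfold_locales (use \<open>a \<noteq> 0\<close> assms in auto)
      have "V \<in> cosets C" by (auto simp: cosets_def V_def)
      then show "?f p \<in> {V \<in> cosets C. min_weight V = 1}"
        using min_weight_V by (simp add: p V_def)
    qed
    show "{V \<in> cosets C. min_weight V = 1} \<subseteq> ?f ` (UNIV \<times> (UNIV - {0}))"
      by (auto elim!: weight_one_coset_obtain)
  qed
  ultimately show ?thesis by (simp add: card_cartesian_product card_Diff_singleton)
qed

end

theorem theorem4p1:
  fixes C :: "('q::{field,finite} ^ 'n::finite) set" and k d :: nat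
  assumes "MDS_code C k d" and "d \<ge> 3"
  shows "card {V \<in> cosets C. min_weight V = 1} = CARD('n) * (CARD('q) - 1) \<and>
    (\<forall>V \<in> cosets C. \<forall>V' \<in> cosets C. min_weight V = 1 \<and> min_weight V' = 1 \<longrightarrow>
       (\<forall>w. weight_count w V = weight_count w V')) \<and>
    (\<forall>V \<in> cosets C. min_weight V = 1 \<longrightarrow>
       (\<forall>w \<in> {0..d - 2} - {1}. weight_count w V = 0) \<and>
       weight_count 1 V = 1 \<and>
       weight_count (d - 1) V = (CARD('n) - 1) choose (d - 1) \<and>
       (\<forall>w \<in> {d..CARD('n)}. int (weight_count w V) =
          int (weight_count w C) - Omega 0 w (CARD('n)) d + Omega 1 w (CARD('n)) d))"
proof -
  interpret mds C k d by unfold_locales (rule assms)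
  have coset: "(\<forall>w \<in> {0..d - 2} - {1}. weight_count w V = 0) \<and>
      weight_count 1 V = 1 \<and>
      weight_count (d - 1) V = (CARD('n) - 1) choose (d - 1) \<and>
      (\<forall>w \<in> {d..CARD('n)}. int (weight_count w V) =
         int (weight_count w C) - Omega 0 w (CARD('n)) d + Omega 1 w (CARD('n)) d) \<and>
      (\<forall>w > CARD('n). weight_count w V = 0)"
    if V: "V \<in> cosets C" "min_weight V = 1" for V
  proof -
    obtain j a where "a \<noteq> 0" and V_eq: "V = (\<lambda>c. c + axis j a) ` C"
      using weight_one_coset_obtain[OF V] .
    interpret c: mds_weight_one_coset C k d j a by unfold_locales (use \<open>a \<noteq> 0\<close> assms in auto)
    show ?thesis
      using c.weight_count_small c.weight_count_1 c.weight_count_pred c.weight_count_large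
        c.weight_count_above
      unfolding c.V_def V_eq[symmetric] by auto
  qed
  have "weight_count w V = weight_count w V'"
    if V: "V \<in> cosets C" "min_weight V = 1" and V': "V' \<in> cosets C" "min_weight V' = 1" for V V' w
  proof -
    consider "w \<in> {0..d - 2} - {1}" | "w = 1" | "w = d - 1" | "w \<in> {d..CARD('n)}" | "w > CARD('n)"
      by force
    then show ?thesis
    proof cases
      \<comment> \<open>The formula involves only \<open>C\<close>, \<open>w\<close>,
        \<open>d\<close> and the length, so both cosets give the same integer.\<close>
      case 4
      then have "int (weight_count w V) = int (weight_count w V')"
        using coset[OF V] coset[OF V'] by simp
      then show ?thesis by simp
    qed (use coset[OF V] coset[OF V'] in auto)
  qed
  then show ?thesis using coset card_weight_one_cosets[OF assms(2)] by blast
qed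

end
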